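(* For any assignment rule $\mathcal X$, the posterior odds process satisfies, for every $t\in\mathbb N$ (almost surely), $$\Gamma_t=(\Gamma_{t-1}+\Pi_t)\,\frac{\Lambda_t}{1-\Pi_t},\qquad\text{where}\quad\Lambda_t=\frac{g_{X_t}(Y_t)}{f_{X_t}(Y_t)}.$$
   Context: Setup. Fix $2\le K<\infty$, $[K]=\{1,\dots,K\}$, $\mathbb N=\{1,2,\dots\}$. There is a latent process $L_t\in\{0,1\}$, $t\ge0$, with $L_t=0$ for $t<\Theta$ and $L_t=1$ for $t\ge\Theta$ ($\Theta$ is the change-point). At each $t\in\mathbb N$ a treatment $X_t\in[K]$ is selected and a response $Y_t$ in a Polish space $\mathbb Y$ is observed; $\mathcal F_t=\sigma(X_s,Y_s:1\le s\le t)$, $\mathcal F_0$ trivial. An assignment rule $\mathcal X=\{X_t\}$ has $X_1$ deterministic and $X_t$ a measurable function of $X_1,\dots,X_{t-1},Y_1,\dots,Y_{t-1}$. Response model: for each $x\in[K]$, $f_x,g_x$ are densities with respect to a $\sigma$-finite measure $\mu$ on $\mathbb Y$; given $X_t=x,L_t=i,\mathcal F_{t-1},L_0,\dots,L_{t-1}$, $Y_t$ has density $f_x$ if $i=0$, $g_x$ if $i=1$. Change-point model: $\pi_0\in[0,1)$ and functions $\pi_t:[K]^t\to[0,1)$ with $\mathsf P(L_0=1)=\pi_0$ and $\mathsf P(L_t=1\mid L_{t-1}=0,\mathcal F_{t-1},X_t)=\Pi_t:=\pi_t(X_1,\dots,X_t)$. Posterior odds: $\Gamma_t=\mathsf P(L_t=1\mid\mathcal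 F_t)/\mathsf P(L_t=0\mid\mathcal F_t)$ for $t\ge0$, with $\Gamma_0=\pi_0/(1-\pi_0)$ (values in $[0,\infty]$, with $a/0=\infty$ for $a>0$). *)

theory Defs
  imports "HOL-Probability.Probability"
begin

definition rv_events :: "'a measure \<Rightarrow> 'b measure \<Rightarrow> ('a \<Rightarrow> 'b) \<Rightarrow> 'a set set" where
  "rv_events M N Z = {Z -` A \<inter> space M | A. A \<in> sets N}"

definition obs_events ::
  "'a measure \<Rightarrow> (nat \<Rightarrow> 'a \<Rightarrow> nat) \<Rightarrow> (nat \<Rightarrow> 'a \<Rightarrow> 'y::polish_space) \<Rightarrow> nat \<Rightarrow> 'a set set" where
  "obs_events M X Y t =
     (\<Union>s\<in>{1..t}. rv_events M (count_space UNIV) (X s) \<union> rv_events M borel (Y s))"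

text \<open>The filtration \<open>\<F>\<^sub>t = \<sigma>(X\<^sub>s, Y\<^sub>s : 1 \<le> s \<le> t)\<close>; it is trivial at \<open>t = 0\<close>.\<close>

definition obs_alg ::
  "'a measure \<Rightarrow> (nat \<Rightarrow> 'a \<Rightarrow> nat) \<Rightarrow> (nat \<Rightarrow> 'a \<Rightarrow> 'y::polish_space) \<Rightarrow> nat \<Rightarrow> 'a measure" where
  "obs_alg M X Y t = sigma (space M) (obs_events M X Y t)"

text \<open>\<open>\<sigma>(\<F>\<^sub>t\<^sub>-\<^sub>1, X\<^sub>t, L\<^sub>t\<^sub>-\<^sub>1)\<close>\<close>

definition change_alg ::
  "'a measure \<Rightarrow> (nat \<Rightarrow> 'a \<Rightarrow> nat) \<Rightarrow> (nat \<Rightarrow> 'a \<Rightarrow> 'y::polish_space) \<Rightarrow> (nat \<Rightarrow> 'a \<Rightarrow> nat) \<Rightarrow>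
   nat \<Rightarrow> 'a measure" where
  "change_alg M X Y L t = sigma (space M)
     (obs_events M X Y (t - 1) \<union> rv_events M (count_space UNIV) (X t)
      \<union> rv_events M (count_space UNIV) (L (t - 1)))"

text \<open>\<open>\<sigma>(\<F>\<^sub>t\<^sub>-\<^sub>1, X\<^sub>t, L\<^sub>0, \<dots>, L\<^sub>t)\<close>\<close>

definition response_alg ::
  "'a measure \<Rightarrow> (nat \<Rightarrow> 'a \<Rightarrow> nat) \<Rightarrow> (nat \<Rightarrow> 'a \<Rightarrow> 'y::polish_space) \<Rightarrow> (nat \<Rightarrow> 'a \<Rightarrow> nat) \<Rightarrow>
   nat \<Rightarrow> 'a measure" where
  "response_alg M X Y L t = sigma (space M)
     (obs_events M X Y (t - 1) \<union> rv_events M (count_space UNIV) (X t)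
      \<union> (\<Union>s\<in>{0..t}. rv_events M (count_space UNIV) (L s)))"

definition cond_pr :: "'a measure \<Rightarrow> 'a measure \<Rightarrow> ('a \<Rightarrow> bool) \<Rightarrow> 'a \<Rightarrow> real" where
  "cond_pr M F P = real_cond_exp M F (indicator {\<omega> \<in> space M. P \<omega>})"

definition is_density :: "'y measure \<Rightarrow> ('y \<Rightarrow> real) \<Rightarrow> bool" where
  "is_density \<mu> h \<longleftrightarrow> h \<in> borel_measurable \<mu> \<and> (\<forall>y. 0 \<le> h y) \<and> (\<integral>\<^sup>+ y. ennreal (h y) \<partial>\<mu>) = 1"

definition assignment_rule ::
  "'a measure \<Rightarrow> nat \<Rightarrow> (nat \<Rightarrow> 'a \<Rightarrow> nat) \<Rightarrow> (nat \<Rightarrow> 'a \<Rightarrow> 'y::polish_space) \<Rightarrow> bool" where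
  "assignment_rule M K X Y \<longleftrightarrow>
     (\<exists>x\<in>{1..K}. \<forall>\<omega>\<in>space M. X 1 \<omega> = x) \<and>
     (\<forall>t\<ge>2. \<exists>\<phi> \<in> measurable
          (PiM {1..t-1} (\<lambda>_. count_space {1..K}) \<Otimes>\<^sub>M PiM {1..t-1} (\<lambda>_. borel))
          (count_space {1..K}).
        \<forall>\<omega>\<in>space M. X t \<omega> = \<phi> (\<lambda>s\<in>{1..t-1}. X s \<omega>, \<lambda>s\<in>{1..t-1}. Y s \<omega>))"

text \<open>\<open>\<Pi>\<^sub>t = \<pi>\<^sub>t(X\<^sub>1, \<dots>, X\<^sub>t)\<close>; an element of \<open>[K]\<^sup>t\<close> is an extensional function on \<open>{1..t}\<close>.\<close>

definition change_prob ::
  "(nat \<Rightarrow> (nat \<Rightarrow> nat) \<Rightarrow> real) \<Rightarrow> (nat \<Rightarrow> 'a \<Rightarrow> nat) \<Rightarrow> nat \<Rightarrow> 'a \<Rightarrow> real" where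
  "change_prob \<pi> X t \<omega> = \<pi> t (\<lambda>s\<in>{1..t}. X s \<omega>)"

text \<open>
  The change-point \<open>\<theta>\<close> may be infinite (no change ever occurs). The conditional law of \<open>Y t\<close> is
  prescribed setwise; for fixed \<open>B\<close> the exceptional null set may depend on \<open>B\<close>.
\<close>

locale change_point_model = prob_space M
  for M :: "'a measure" +
  fixes K :: nat
    and X :: "nat \<Rightarrow> 'a \<Rightarrow> nat"
    and Y :: "nat \<Rightarrow> 'a \<Rightarrow> 'y::polish_space"
    and L :: "nat \<Rightarrow> 'a \<Rightarrow> nat"
    and \<theta> :: "'a \<Rightarrow> enat"
    and \<mu> :: "'y measure"
    and f g :: "nat \<Rightarrow> 'y \<Rightarrow> real"
    and \<pi>\<^sub>0 :: real
    and \<pi> :: "nat \<Rightarrow> (nat \<Rightarrow> nat) \<Rightarrow> real"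
  assumes K_ge_2: "2 \<le> K"
    and X_rv: "\<And>t. 1 \<le> t \<Longrightarrow> X t \<in> measurable M (count_space {1..K})"
    and Y_rv: "\<And>t. 1 \<le> t \<Longrightarrow> Y t \<in> measurable M borel"
    and L_rv: "\<And>t. L t \<in> measurable M (count_space {0, 1})"
    and L_eq: "\<And>t \<omega>. \<omega> \<in> space M \<Longrightarrow> L t \<omega> = (if enat t < \<theta> \<omega> then 0 else 1)"
    and sets_mu: "sets \<mu> = sets borel"
    and mu_sigma_finite: "sigma_finite_measure \<mu>"
    and f_density: "\<And>x. x \<in> {1..K} \<Longrightarrow> is_density \<mu> (f x)"
    and g_density: "\<And>x. x \<in> {1..K} \<Longrightarrow> is_density \<mu> (g x)"
    and response: "\<And>t B. 1 \<le> t \<Longrightarrow> B \<in> sets borel \<Longrightarrow>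
      AE \<omega> in M. cond_pr M (response_alg M X Y L t) (\<lambda>\<omega>. Y t \<omega> \<in> B) \<omega> =
        (LINT y:B|\<mu>. (if L t \<omega> = 0 then f (X t \<omega>) y else g (X t \<omega>) y))"
    and pi0_range: "\<pi>\<^sub>0 \<in> {0..<1}"
    and pi_range: "\<And>t x. 1 \<le> t \<Longrightarrow> x \<in> {1..t} \<rightarrow>\<^sub>E {1..K} \<Longrightarrow> \<pi> t x \<in> {0..<1}"
    and initial: "prob {\<omega> \<in> space M. L 0 \<omega> = 1} = \<pi>\<^sub>0"
    and change: "\<And>t. 1 \<le> t \<Longrightarrow>
      AE \<omega> in M. L (t - 1) \<omega> = 0 \<longrightarrow>
        cond_pr M (change_alg M X Y L t) (\<lambda>\<omega>. L t \<omega> = 1) \<omega> = change_prob \<pi> X t \<omega>"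

text \<open>
  Odds and likelihood ratios take values in \<open>[0, \<infinity>]\<close>: in \<^typ>\<open>ennreal\<close>, \<open>a / 0 = \<infinity>\<close> for \<open>a > 0\<close>,
  while \<open>0 / 0 = 0\<close> and \<open>0 * \<infinity> = 0\<close>.
\<close>

definition post_odds ::
  "'a measure \<Rightarrow> (nat \<Rightarrow> 'a \<Rightarrow> nat) \<Rightarrow> (nat \<Rightarrow> 'a \<Rightarrow> 'y::polish_space) \<Rightarrow> (nat \<Rightarrow> 'a \<Rightarrow> nat) \<Rightarrow>
   nat \<Rightarrow> 'a \<Rightarrow> ennreal" where
  "post_odds M X Y L t \<omega> =
     ennreal (cond_pr M (obs_alg M X Y t) (\<lambda>\<omega>. L t \<omega> = 1) \<omega>) /
     ennreal (cond_pr M (obs_alg M X Y t) (\<lambda>\<omega>. L t \<omega> = 0) \<omega>)"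

definition lik_ratio ::
  "(nat \<Rightarrow> 'y \<Rightarrow> real) \<Rightarrow> (nat \<Rightarrow> 'y \<Rightarrow> real) \<Rightarrow> (nat \<Rightarrow> 'a \<Rightarrow> nat) \<Rightarrow> (nat \<Rightarrow> 'a \<Rightarrow> 'y) \<Rightarrow>
   nat \<Rightarrow> 'a \<Rightarrow> ennreal" where
  "lik_ratio f g X Y t \<omega> = ennreal (g (X t \<omega>) (Y t \<omega>)) / ennreal (f (X t \<omega>) (Y t \<omega>))"

lemma (in prob_space) cond_pr_trivial:
  assumes P: "{\<omega> \<in> space M. P \<omega>} \<in> sets M" and \<omega>: "\<omega> \<in> space M"
  shows "cond_pr M (sigma (space M) {}) P \<omega> = prob {\<omega> \<in> space M. P \<omega>}"
proof -
  let ?F = "sigma (space M) {}"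
  let ?h = "cond_pr M ?F P"
  have sub: "subalgebra M ?F"
    by (auto simp: subalgebra_def sigma_sets_empty_eq)
  then interpret finite_measure_subalgebra M ?F
    by unfold_locales
  have int: "integrable M (indicator {\<omega> \<in> space M. P \<omega>} :: _ \<Rightarrow> real)"
    using P by (simp add: emeasure_eq_measure)
  have meas: "?h \<in> borel_measurable ?F"
    unfolding cond_pr_def by simp
  have "?h -` {?h \<omega>} \<inter> space M \<in> sets ?F"
    using measurable_sets[OF meas, of "{?h \<omega>}"] by simp
  then have "?h -` {?h \<omega>} \<inter> space M = space M"
    using \<omega> by (auto simp: sigma_sets_empty_eq)
  then have const: "?h x = ?h \<omega>" if "x \<in> space M" for x
    using that by auto
  have "integral\<^sup>L M ?h = prob {\<omega> \<in> space M. P \<omega>}"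
    unfolding cond_pr_def using real_cond_exp_int(2)[OF int] P by (simp add: Int_absorb2)
  moreover have "integral\<^sup>L M ?h = integral\<^sup>L M (\<lambda>_. ?h \<omega>)"
    using const by (intro Bochner_Integration.integral_cong) auto
  ultimately show ?thesis by (simp add: prob_space)
qed

lemma (in change_point_model) post_odds_0:
  assumes "\<omega> \<in> space M"
  shows "post_odds M X Y L 0 \<omega> = ennreal (\<pi>\<^sub>0 / (1 - \<pi>\<^sub>0))"
proof -
  have F0: "obs_alg M X Y 0 = sigma (space M) {}"
    by (simp add: obs_alg_def obs_events_def)
  have meas: "{\<omega> \<in> space M. L 0 \<omega> = i} \<in> sets M" if "i \<in> {0, 1}" for i
    using measurable_sets[OF L_rv[of 0], of "{i}"] that
    by (auto simp: vimage_def Int_def conj_commute)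
  have "{\<omega> \<in> space M. L 0 \<omega> = 0} = space M - {\<omega> \<in> space M. L 0 \<omega> = 1}"
    using L_eq[of _ 0] by (auto split: if_splits)
  then have "prob {\<omega> \<in> space M. L 0 \<omega> = 0} = 1 - \<pi>\<^sub>0"
    using prob_compl[OF meas[of 1]] initial by simp
  then show ?thesis
    using assms initial meas pi0_range
    by (simp add: post_odds_def F0 cond_pr_trivial divide_ennreal)
qed

end

theory Submission
  imports Defs
begin

text \<open>
  With \<open>p\<close> and \<open>q\<close> the posterior probabilities of \<open>L\<^sub>t\<^sub>-\<^sub>1 = 1\<close> and \<open>L\<^sub>t\<^sub>-\<^sub>1 = 0\<close>, the subdensities of \<open>Y\<^sub>t\<close>
  given \<open>\<F>\<^sub>t\<^sub>-\<^sub>1\<close> on the events \<open>L\<^sub>t = 1\<close> and \<open>L\<^sub>t = 0\<close> are \<open>A = (p + q \<Pi>\<^sub>t) g\<close> and \<open>B = q (1 - \<Pi>\<^sub>t) f\<close>;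
  here \<open>X\<^sub>t\<close> and \<open>\<Pi>\<^sub>t\<close> are \<open>\<F>\<^sub>t\<^sub>-\<^sub>1\<close>-measurable because of the assignment rule. Bayes' formula gives
  \<open>P(L\<^sub>t = 1 | \<F>\<^sub>t) = A / (A + B)\<close> with \<open>A + B > 0\<close> almost surely. The positivity excludes the
  indeterminate cases, so that dividing is legitimate in \<open>[0, \<infinity>]\<close>.
\<close>

section \<open>Conditional probabilities of events through nonnegative integrals\<close>

text \<open>Working with \<open>emeasure\<close> and \<open>nn_integral\<close> spares integrability
  conditions later: the case \<open>C = space M\<close> already bounds the integral of
  \<open>h\<close> by the probability of \<open>E\<close>, so \<open>h\<close> is integrable and
  \<open>real_cond_exp_charact\<close> applies.\<close>

lemma (in prob_space) real_cond_exp_indicator_charact: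
  assumes sub: "subalgebra M H" and E: "E \<in> sets M"
    and h: "h \<in> borel_measurable H" "\<And>\<omega>. 0 \<le> h \<omega>"
    and eq: "\<And>C. C \<in> sets H \<Longrightarrow> emeasure M (E \<inter> C) = (\<integral>\<^sup>+\<omega>. ennreal (h \<omega>) * indicator C \<omega> \<partial>M)"
  shows "AE \<omega> in M. real_cond_exp M H (indicator E) \<omega> = h \<omega>"
proof -
  interpret finite_measure_subalgebra M H
    using sub by unfold_locales
  have hM[measurable]: "h \<in> borel_measurable M"
    by (rule measurable_from_subalg[OF sub h(1)])
  have spH: "space H = space M" and HM: "\<And>C. C \<in> sets H \<Longrightarrow> C \<in> sets M"
    using sub by (auto simp: subalgebra_def)
  have "(\<integral>\<^sup>+\<omega>. ennreal (h \<omega>) \<partial>M) = (\<integral>\<^sup>+\<omega>. ennreal (h \<omega>) * indicator (space M) \<omega> \<partial>M)"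
    by (intro nn_integral_cong) simp
  also have "\<dots> = emeasure M (E \<inter> space M)"
    using eq[of "space M"] sets.top[of H] spH by simp
  finally have "(\<integral>\<^sup>+\<omega>. ennreal (h \<omega>) \<partial>M) < \<infinity>"
    by (simp add: emeasure_eq_measure)
  then have int: "integrable M h"
    using h(2) by (intro integrableI_nonneg) auto
  show ?thesis
  proof (rule real_cond_exp_charact)
    fix C assume C: "C \<in> sets H"
    then have [measurable]: "C \<in> sets M" by (rule HM)
    have "ennreal (\<integral>\<omega>\<in>C. h \<omega> \<partial>M) = (\<integral>\<^sup>+\<omega>. ennreal (h \<omega>) * indicator C \<omega> \<partial>M)"
      unfolding set_lebesgue_integral_def using int h(2)
      by (subst nn_integral_eq_integral[symmetric])
         (auto intro!: integrable_real_mult_indicator nn_integral_cong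
           simp: mult.commute[of "indicator C _"] ennreal_mult ennreal_indicator)
    also have "\<dots> = ennreal (measure M (E \<inter> C))"
      using eq[OF C] by (simp add: emeasure_eq_measure)
    finally have "(\<integral>\<omega>\<in>C. h \<omega> \<partial>M) = measure M (E \<inter> C)"
      using h(2) by (subst (asm) ennreal_inj)
        (auto simp: set_lebesgue_integral_def intro!: integral_nonneg_AE)
    moreover have "(\<integral>\<omega>\<in>C. indicator E \<omega> \<partial>M) = measure M (E \<inter> C)"
      using E by (simp add: set_lebesgue_integral_def flip: indicator_inter_arith)
        (simp add: Int_commute Int_absorb2 sets.sets_into_space)
    ultimately show "(\<integral>\<omega>\<in>C. indicator E \<omega> \<partial>M) = (\<integral>\<omega>\<in>C. h \<omega> \<partial>M)"
      by simp
  qed (use E int h(1) in \<open>auto simp: emeasure_eq_measure\<close>)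
qed

lemma (in prob_space) real_cond_exp_indicator_nonneg:
  assumes "subalgebra M H" and E: "E \<in> sets M"
  shows "AE \<omega> in M. 0 \<le> real_cond_exp M H (indicator E) \<omega>"
proof -
  interpret finite_measure_subalgebra M H
    using assms by unfold_locales
  show ?thesis
    using E by (intro real_cond_exp_pos) auto
qed

text \<open>\<open>real_cond_exp\<close> is built from \<open>nn_cond_exp\<close> of the positive
  and negative parts. For an indicator the negative part vanishes and the positive part is almost
  surely finite, so nothing is lost in passing to reals, and the averaging property holds for every
  \<open>[0, \<infinity>]\<close>-valued weight \<open>u\<close>.\<close>

lemma (in prob_space) nn_integral_real_cond_exp_indicator:
  assumes sub: "subalgebra M H" and E: "E \<in> sets M" and u: "u \<in> borel_measurable H"
  shows "(\<integral>\<^sup>+\<omega>. u \<omega> * indicator E \<omega> \<partial>M) =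
    (\<integral>\<^sup>+\<omega>. u \<omega> * ennreal (real_cond_exp M H (indicator E) \<omega>) \<partial>M)"
proof -
  interpret finite_measure_subalgebra M H
    using sub by unfold_locales
  have [measurable]: "E \<in> sets M" by fact
  have fin: "AE \<omega> in M. nn_cond_exp M H (indicator E) \<omega> \<noteq> \<infinity>"
  proof (rule nn_integral_PInf_AE)
    show "integral\<^sup>N M (nn_cond_exp M H (indicator E)) \<noteq> \<infinity>"
      using nn_cond_exp_intg[of "\<lambda>_. 1" "indicator E"] by (simp add: emeasure_eq_measure)
  qed simp
  have "(\<lambda>\<omega>. ennreal (indicator E \<omega>)) = indicator E" "(\<lambda>\<omega>. ennreal (- indicator E \<omega>)) = (\<lambda>_. 0)"
    by (auto simp: ennreal_indicator fun_eq_iff ennreal_neg)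
  moreover have "AE \<omega> in M. nn_cond_exp M H (\<lambda>_. 0) \<omega> = 0"
    using nn_cond_exp_F_meas[of "\<lambda>_. 0"] by simp
  ultimately have "AE \<omega> in M. ennreal (real_cond_exp M H (indicator E) \<omega>) = nn_cond_exp M H (indicator E) \<omega>"
    unfolding real_cond_exp_def using fin by (auto simp: less_top)
  then have "(\<integral>\<^sup>+\<omega>. u \<omega> * ennreal (real_cond_exp M H (indicator E) \<omega>) \<partial>M) =
     (\<integral>\<^sup>+\<omega>. u \<omega> * nn_cond_exp M H (indicator E) \<omega> \<partial>M)"
    by (intro nn_integral_cong_AE) auto
  also have "\<dots> = (\<integral>\<^sup>+\<omega>. u \<omega> * indicator E \<omega> \<partial>M)"
    using u by (intro nn_cond_exp_intg) auto
  finally show ?thesis by simp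
qed

lemma (in prob_space) real_cond_exp_indicator_compl:
  assumes sub: "subalgebra M H" and E: "E \<in> sets M"
  shows "AE \<omega> in M. real_cond_exp M H (indicator (space M - E)) \<omega> =
    1 - real_cond_exp M H (indicator E) \<omega>"
proof -
  interpret finite_measure_subalgebra M H
    using sub by unfold_locales
  let ?E = "space M - E"
  have [measurable]: "E \<in> sets M" by fact
  have int: "integrable M (indicator E :: _ \<Rightarrow> real)" "integrable M (indicator ?E :: _ \<Rightarrow> real)"
    by (auto simp: emeasure_eq_measure)
  have "AE \<omega> in M. real_cond_exp M H (\<lambda>\<omega>. indicator ?E \<omega> + indicator E \<omega>) \<omega> =
      real_cond_exp M H (indicator ?E) \<omega> + real_cond_exp M H (indicator E) \<omega>"
    using int by (intro real_cond_exp_add)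
  moreover have "AE \<omega> in M. real_cond_exp M H (\<lambda>\<omega>. indicator ?E \<omega> + indicator E \<omega>) \<omega> =
      real_cond_exp M H (\<lambda>_. 1) \<omega>"
    by (intro real_cond_exp_cong) (auto simp: indicator_def)
  moreover have "AE \<omega> in M. real_cond_exp M H (\<lambda>_. 1) \<omega> = 1"
    by (intro real_cond_exp_F_meas) auto
  ultimately show ?thesis
    by eventually_elim simp
qed

section \<open>Joint laws and Bayes' formula\<close>

text \<open>The pair \<open>(\<omega>, Y \<omega>)\<close> carries all of \<open>G\<close> along
  with \<open>Y\<close>. Its law on the event \<open>E\<close> is finite, hence determined by the
  rectangles \<open>D \<times> C\<close>, where \<open>rect\<close> identifies it with the density
  \<open>A\<close> relative to the product of \<open>M\<close> restricted to \<open>G\<close> with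
  \<open>\<mu>\<close>.\<close>

lemma (in prob_space) nn_integral_joint_law:
  assumes sub: "subalgebra M G" and mu: "sigma_finite_measure \<mu>"
    and Y[measurable]: "Y \<in> measurable M \<mu>" and E[measurable]: "E \<in> sets M"
    and A: "A \<in> borel_measurable (G \<Otimes>\<^sub>M \<mu>)"
    and rect: "\<And>D C. D \<in> sets G \<Longrightarrow> C \<in> sets \<mu> \<Longrightarrow>
      emeasure M (E \<inter> (D \<inter> Y -` C)) =
        (\<integral>\<^sup>+\<omega>. (\<integral>\<^sup>+y. A (\<omega>, y) * indicator C y \<partial>\<mu>) * indicator D \<omega> \<partial>M)"
    and u: "u \<in> borel_measurable (G \<Otimes>\<^sub>M \<mu>)"
  shows "(\<integral>\<^sup>+\<omega>. u (\<omega>, Y \<omega>) * indicator E \<omega> \<partial>M) =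
    (\<integral>\<^sup>+z. u z * A z \<partial>(restr_to_subalg M G \<Otimes>\<^sub>M \<mu>))"
proof -
  let ?Q = "restr_to_subalg M G"
  let ?P = "?Q \<Otimes>\<^sub>M \<mu>"
  interpret \<mu>: sigma_finite_measure \<mu> by fact
  have setsQ[measurable_cong]: "sets ?Q = sets G"
    using sub by (rule sets_restr_to_subalg)
  have spQ: "space ?Q = space M" by (rule space_restr_to_subalg)
  have spG: "space G = space M" using sub by (auto simp: subalgebra_def)
  have setsP[measurable_cong]: "sets ?P = sets (G \<Otimes>\<^sub>M \<mu>)"
    by (rule sets_pair_measure_cong[OF setsQ refl])
  have [measurable]: "A \<in> borel_measurable ?P" "u \<in> borel_measurable ?P"
    using A u by (simp_all add: measurable_cong_sets[OF setsP refl])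
  have "id \<in> measurable M ?Q"
    using sub unfolding measurable_def spQ setsQ by (auto simp: subalgebra_def Int_absorb2 sets.sets_into_space)
  then have idQ: "(\<lambda>\<omega>. \<omega>) \<in> measurable M ?Q" by (simp add: id_def)
  have YP: "(\<lambda>\<omega>. (\<omega>, Y \<omega>)) \<in> measurable M ?P"
    using idQ Y by (rule measurable_Pair)
  have YP': "(\<lambda>\<omega>. (\<omega>, Y \<omega>)) \<in> measurable (density M (indicator E)) ?P"
    using YP by simp
  \<comment> \<open>The weight \<open>indicator E\<close> cuts \<open>M\<close> down to
    \<open>E\<close>, so \<open>?D\<close> has total mass \<open>prob E\<close>.\<close>
  let ?D = "distr (density M (indicator E)) ?P (\<lambda>\<omega>. (\<omega>, Y \<omega>))"
  have emD: "emeasure ?D S = emeasure M (E \<inter> ((\<lambda>\<omega>. (\<omega>, Y \<omega>)) -` S))" if S: "S \<in> sets ?P" for S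
  proof -
    have *: "(\<lambda>\<omega>. (\<omega>, Y \<omega>)) -` S \<inter> space M \<in> sets M"
      using measurable_sets[OF YP S] .
    have "emeasure ?D S = emeasure (density M (indicator E)) ((\<lambda>\<omega>. (\<omega>, Y \<omega>)) -` S \<inter> space M)"
      using YP' S by (subst emeasure_distr) auto
    also have "\<dots> = emeasure M (E \<inter> ((\<lambda>\<omega>. (\<omega>, Y \<omega>)) -` S \<inter> space M))"
      using *
      by (subst emeasure_density) (auto simp: nn_integral_indicator simp flip: indicator_inter_arith)
    also have "E \<inter> ((\<lambda>\<omega>. (\<omega>, Y \<omega>)) -` S \<inter> space M) = E \<inter> ((\<lambda>\<omega>. (\<omega>, Y \<omega>)) -` S)"
      using sets.sets_into_space[OF E] by auto
    finally show ?thesis .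
  qed
  let ?R = "{a \<times> b | a b. a \<in> sets ?Q \<and> b \<in> sets \<mu>}"
  have "?D = density ?P A"
  proof (rule measure_eqI_generator_eq[OF Int_stable_pair_measure_generator[of ?Q \<mu>],
        where \<Omega>="space ?Q \<times> space \<mu>" and A="\<lambda>_. space ?Q \<times> space \<mu>"])
    show "?R \<subseteq> Pow (space ?Q \<times> space \<mu>)"
      by (rule pair_measure_closed)
    show "sets ?D = sigma_sets (space ?Q \<times> space \<mu>) ?R"
         "sets (density ?P A) = sigma_sets (space ?Q \<times> space \<mu>) ?R"
      by (simp_all add: sets_pair_measure)
    fix S assume "S \<in> ?R"
    then obtain D C where S: "S = D \<times> C" and DC: "D \<in> sets ?Q" "C \<in> sets \<mu>" by auto
    then have [measurable]: "S \<in> sets ?P" "D \<in> sets ?Q" "C \<in> sets \<mu>" by auto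
    have "emeasure ?D S = emeasure M (E \<inter> ((\<lambda>\<omega>. (\<omega>, Y \<omega>)) -` S))"
      by (rule emD) simp
    also have "(\<lambda>\<omega>. (\<omega>, Y \<omega>)) -` S = D \<inter> Y -` C"
      unfolding S by auto
    also have "emeasure M (E \<inter> (D \<inter> Y -` C)) = (\<integral>\<^sup>+\<omega>. (\<integral>\<^sup>+y. A (\<omega>, y) * indicator C y \<partial>\<mu>) * indicator D \<omega> \<partial>M)"
      using DC setsQ by (intro rect) auto
    \<comment> \<open>The inner integral and \<open>D\<close> are \<open>G\<close>-measurable, so
      \<open>M\<close> and its restriction to \<open>G\<close> give the same value; Fubini is then
      applied over the restriction.\<close>
    also have "\<dots> = (\<integral>\<^sup>+\<omega>. (\<integral>\<^sup>+y. A (\<omega>, y) * indicator C y \<partial>\<mu>) * indicator D \<omega> \<partial>?Q)"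
      using A DC(1) setsQ by (intro nn_integral_subalgebra2[OF sub, symmetric]) simp
    also have "\<dots> = (\<integral>\<^sup>+\<omega>. (\<integral>\<^sup>+y. A (\<omega>, y) * indicator S (\<omega>, y) \<partial>\<mu>) \<partial>?Q)"
      by (intro nn_integral_cong) (auto simp: S indicator_def)
    also have "\<dots> = (\<integral>\<^sup>+z. A z * indicator S z \<partial>?P)"
      by (intro \<mu>.nn_integral_fst[where f="\<lambda>z. A z * indicator S z"]) measurable
    also have "\<dots> = emeasure (density ?P A) S"
      by (subst emeasure_density) auto
    finally show "emeasure ?D S = emeasure (density ?P A) S" .
  next
    show "range (\<lambda>_. space ?Q \<times> space \<mu>) \<subseteq> ?R" by auto
    fix i
    show "emeasure ?D (space ?Q \<times> space \<mu>) \<noteq> \<infinity>"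
      by (subst emD) (auto simp: emeasure_eq_measure)
  qed simp
  then have "(\<integral>\<^sup>+z. u z \<partial>?D) = (\<integral>\<^sup>+z. A z * u z \<partial>?P)"
    by (simp add: nn_integral_density)
  moreover have "(\<integral>\<^sup>+z. u z \<partial>?D) = (\<integral>\<^sup>+\<omega>. indicator E \<omega> * u (\<omega>, Y \<omega>) \<partial>M)"
    using measurable_compose[OF YP \<open>u \<in> borel_measurable ?P\<close>] YP'
    by (simp add: nn_integral_distr nn_integral_density)
  ultimately show ?thesis by (simp add: mult.commute)
qed

text \<open>\<open>setsH\<close> says that \<open>H\<close> is generated by \<open>G\<close> and
  \<open>Y\<close>, so an event of \<open>H\<close> is a condition on the pair
  \<open>(\<omega>, Y \<omega>)\<close>. That pair has density \<open>A + B\<close>, of which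
  \<open>A\<close> is the part coming from \<open>E\<close>; the conditional probability is
  therefore the ratio, defined almost surely because a law does not charge the zero set of its
  density.\<close>

lemma (in prob_space) bayes_formula:
  fixes A B :: "'a \<times> 'y \<Rightarrow> real"
  assumes G: "subalgebra M G" and H: "subalgebra M H" and mu: "sigma_finite_measure \<mu>"
    and Y: "Y \<in> measurable M \<mu>" and E[measurable]: "E \<in> sets M"
    and setsH: "sets H = sets (vimage_algebra (space M) (\<lambda>\<omega>. (\<omega>, Y \<omega>)) (G \<Otimes>\<^sub>M \<mu>))"
    and A[measurable]: "A \<in> borel_measurable (G \<Otimes>\<^sub>M \<mu>)" "\<And>z. 0 \<le> A z"
    and B[measurable]: "B \<in> borel_measurable (G \<Otimes>\<^sub>M \<mu>)" "\<And>z. 0 \<le> B z"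
    and rectA: "\<And>D C. D \<in> sets G \<Longrightarrow> C \<in> sets \<mu> \<Longrightarrow>
      emeasure M (E \<inter> (D \<inter> Y -` C)) =
        (\<integral>\<^sup>+\<omega>. (\<integral>\<^sup>+y. ennreal (A (\<omega>, y)) * indicator C y \<partial>\<mu>) * indicator D \<omega> \<partial>M)"
    and rectB: "\<And>D C. D \<in> sets G \<Longrightarrow> C \<in> sets \<mu> \<Longrightarrow>
      emeasure M ((space M - E) \<inter> (D \<inter> Y -` C)) =
        (\<integral>\<^sup>+\<omega>. (\<integral>\<^sup>+y. ennreal (B (\<omega>, y)) * indicator C y \<partial>\<mu>) * indicator D \<omega> \<partial>M)"
  shows "AE \<omega> in M. 0 < A (\<omega>, Y \<omega>) + B (\<omega>, Y \<omega>) \<and>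
    real_cond_exp M H (indicator E) \<omega> = A (\<omega>, Y \<omega>) / (A (\<omega>, Y \<omega>) + B (\<omega>, Y \<omega>))"
proof -
  let ?Z = "\<lambda>\<omega>. (\<omega>, Y \<omega>)"
  let ?P = "restr_to_subalg M G \<Otimes>\<^sub>M \<mu>"
  have setsP[measurable_cong]: "sets ?P = sets (G \<Otimes>\<^sub>M \<mu>)"
    using G by (intro sets_pair_measure_cong sets_restr_to_subalg refl)
  have spG: "space G = space M" and spH: "space H = space M"
    using G H by (auto simp: subalgebra_def)
  have Zsp: "?Z \<in> space M \<rightarrow> space (G \<Otimes>\<^sub>M \<mu>)"
    using measurable_space[OF Y] by (auto simp: space_pair_measure spG)
  have ZH: "?Z \<in> measurable H (G \<Otimes>\<^sub>M \<mu>)"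
    using measurable_vimage_algebra1[OF Zsp] by (simp add: measurable_cong_sets[OF setsH refl])
  have ZM: "?Z \<in> measurable M (G \<Otimes>\<^sub>M \<mu>)"
    by (rule measurable_from_subalg[OF H ZH])
  note lawA = nn_integral_joint_law[OF G mu Y E measurable_compose[OF A(1) measurable_ennreal] rectA]
  have E': "space M - E \<in> sets M" by simp
  note lawB = nn_integral_joint_law[OF G mu Y E' measurable_compose[OF B(1) measurable_ennreal] rectB]
  \<comment> \<open>Adding the laws on \<open>E\<close> and on its complement gives the law of the
    pair under \<open>M\<close>.\<close>
  have total: "(\<integral>\<^sup>+\<omega>. u (?Z \<omega>) \<partial>M) = (\<integral>\<^sup>+z. u z * ennreal (A z + B z) \<partial>?P)"
    if u[measurable]: "u \<in> borel_measurable (G \<Otimes>\<^sub>M \<mu>)" for u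
  proof -
    have [measurable]: "(\<lambda>\<omega>. u (?Z \<omega>)) \<in> borel_measurable M"
      by (rule measurable_compose[OF ZM u])
    have "(\<integral>\<^sup>+\<omega>. u (?Z \<omega>) \<partial>M) =
        (\<integral>\<^sup>+\<omega>. u (?Z \<omega>) * indicator E \<omega> + u (?Z \<omega>) * indicator (space M - E) \<omega> \<partial>M)"
      by (intro nn_integral_cong) (auto simp: indicator_def)
    also have "\<dots> = (\<integral>\<^sup>+\<omega>. u (?Z \<omega>) * indicator E \<omega> \<partial>M) +
        (\<integral>\<^sup>+\<omega>. u (?Z \<omega>) * indicator (space M - E) \<omega> \<partial>M)"
      by (intro nn_integral_add) measurable
    also have "\<dots> = (\<integral>\<^sup>+z. u z * ennreal (A z) \<partial>?P) + (\<integral>\<^sup>+z. u z * ennreal (B z) \<partial>?P)"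
      by (simp only: lawA[OF _ _ u] lawB[OF _ _ u])
    also have "\<dots> = (\<integral>\<^sup>+z. u z * ennreal (A z + B z) \<partial>?P)"
      by (subst nn_integral_add[symmetric]) (auto simp: A(2) B(2) distrib_left)
    finally show ?thesis .
  qed
  \<comment> \<open>Integrating the indicator of this zero set with \<open>total\<close> shows that
    the pair almost surely avoids it.\<close>
  let ?N = "{z \<in> space (G \<Otimes>\<^sub>M \<mu>). A z + B z = 0}"
  have N[measurable]: "?N \<in> sets (G \<Otimes>\<^sub>M \<mu>)" by measurable
  have "(\<integral>\<^sup>+\<omega>. indicator ?N (?Z \<omega>) \<partial>M) = (\<integral>\<^sup>+z. indicator ?N z * ennreal (A z + B z) \<partial>?P)"
    by (rule total) measurable
  also have "\<dots> = (\<integral>\<^sup>+z. 0 \<partial>?P)"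
    by (intro nn_integral_cong) (auto simp: indicator_def)
  finally have "(\<integral>\<^sup>+\<omega>. indicator ?N (?Z \<omega>) \<partial>M) = 0" by simp
  moreover have "(\<lambda>\<omega>. indicator ?N (?Z \<omega>) :: ennreal) \<in> borel_measurable M"
    by (rule measurable_compose[OF ZM]) measurable
  ultimately have "AE \<omega> in M. (indicator ?N (?Z \<omega>) :: ennreal) = 0"
    by (simp add: nn_integral_0_iff_AE)
  then have pos: "AE \<omega> in M. 0 < A (?Z \<omega>) + B (?Z \<omega>)"
  proof (rule AE_mp, intro AE_I2 impI)
    fix \<omega> assume "\<omega> \<in> space M" "(indicator ?N (?Z \<omega>) :: ennreal) = 0"
    then have "A (?Z \<omega>) + B (?Z \<omega>) \<noteq> 0"
      using Zsp by (auto simp: indicator_def split: if_splits)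
    then show "0 < A (?Z \<omega>) + B (?Z \<omega>)"
      using A(2)[of "?Z \<omega>"] B(2)[of "?Z \<omega>"] by linarith
  qed
  have "AE \<omega> in M. real_cond_exp M H (indicator E) \<omega> = A (?Z \<omega>) / (A (?Z \<omega>) + B (?Z \<omega>))"
  proof (rule real_cond_exp_indicator_charact[OF H E])
    show "(\<lambda>\<omega>. A (?Z \<omega>) / (A (?Z \<omega>) + B (?Z \<omega>))) \<in> borel_measurable H"
      by (rule measurable_compose[OF ZH, of "\<lambda>z. A z / (A z + B z)"]) measurable
    show "0 \<le> A (?Z \<omega>) / (A (?Z \<omega>) + B (?Z \<omega>))" for \<omega>
      by (simp add: A(2) B(2))
    fix C assume "C \<in> sets H"
    then obtain S where S[measurable]: "S \<in> sets (G \<Otimes>\<^sub>M \<mu>)" and C: "C = ?Z -` S \<inter> space M"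
      unfolding setsH sets_vimage_algebra2[OF Zsp] by auto
    have [measurable]: "C \<in> sets M"
      unfolding C by (rule measurable_sets[OF ZM S])
    let ?u = "\<lambda>z. ennreal (A z / (A z + B z)) * indicator S z"
    \<comment> \<open>When \<open>A z + B z = 0\<close>, nonnegativity forces
      \<open>A z = 0\<close>; as division by zero gives zero, the identity holds without
      exception.\<close>
    have *: "A z / (A z + B z) * (A z + B z) = A z" for z
      using add_nonneg_eq_0_iff[OF A(2) B(2), of z z] by (cases "A z + B z = 0") auto
    have "emeasure M (E \<inter> C) = (\<integral>\<^sup>+\<omega>. indicator (E \<inter> C) \<omega> \<partial>M)"
      by simp
    also have "\<dots> = (\<integral>\<^sup>+\<omega>. indicator S (?Z \<omega>) * indicator E \<omega> \<partial>M)"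
      by (intro nn_integral_cong) (auto simp: C indicator_def)
    also have "\<dots> = (\<integral>\<^sup>+z. indicator S z * ennreal (A z) \<partial>?P)"
      by (rule lawA) simp_all
    also have "\<dots> = (\<integral>\<^sup>+z. ?u z * ennreal (A z + B z) \<partial>?P)"
    proof (intro nn_integral_cong)
      fix z
      have "ennreal (A z) = ennreal (A z / (A z + B z)) * ennreal (A z + B z)"
        by (subst ennreal_mult[symmetric]) (simp_all add: A(2) B(2) * del: times_divide_eq_left)
      then show "indicator S z * ennreal (A z) = ?u z * ennreal (A z + B z)"
        by (simp add: ac_simps)
    qed
    also have "\<dots> = (\<integral>\<^sup>+\<omega>. ?u (?Z \<omega>) \<partial>M)"
      by (rule total[symmetric]) measurable
    also have "\<dots> = (\<integral>\<^sup>+\<omega>. ennreal (A (?Z \<omega>) / (A (?Z \<omega>) + B (?Z \<omega>))) * indicator C \<omega> \<partial>M)"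
      by (intro nn_integral_cong) (auto simp: C indicator_def)
    finally show "emeasure M (E \<inter> C) = \<dots>" .
  qed
  with pos show ?thesis by eventually_elim simp
qed

section \<open>Sigma-algebras generated by random variables\<close>

lemma subalgebra_sigma:
  assumes "S \<subseteq> sets M"
  shows "subalgebra M (sigma (space M) S)"
proof -
  have "S \<subseteq> Pow (space M)"
    using assms sets.space_closed[of M] by (rule subset_trans)
  then show ?thesis
    using sets.sigma_sets_subset[OF assms] by (simp add: subalgebra_def)
qed

lemma rv_events_subset: "Z \<in> measurable M N \<Longrightarrow> rv_events M N Z \<subseteq> sets M"
  unfolding rv_events_def using measurable_sets by fastforce

lemma rv_events_measurable:
  assumes "Z \<in> space M \<rightarrow> space N" "rv_events M N Z \<subseteq> sets F" "space F = space M"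
  shows "Z \<in> measurable F N"
proof (rule measurableI)
  show "Z x \<in> space N" if "x \<in> space F" for x
    using that assms(1,3) by auto
  show "Z -` A \<inter> space F \<in> sets F" if "A \<in> sets N" for A
  proof -
    have "Z -` A \<inter> space M \<in> rv_events M N Z"
      using that unfolding rv_events_def by auto
    then show ?thesis using assms(2,3) by auto
  qed
qed

section \<open>The odds update in \<open>[0, \<infinity>]\<close>\<close>

text \<open>\<open>a\<close> and \<open>b\<close> are the unnormalized posterior weights of the
  states \<open>1\<close> and \<open>0\<close>; the normalizer \<open>a + b\<close> cancels in the
  quotient. For \<open>b > 0\<close> everything is finite and real algebra suffices. For
  \<open>b = 0\<close> both sides are infinite, since \<open>0 < a\<close> rules out a product
  \<open>0 * \<infinity>\<close> on the right.\<close>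

lemma posterior_odds_update:
  fixes p q P \<phi> \<gamma> :: real
  defines "a \<equiv> (p + q * P) * \<gamma>" and "b \<equiv> q * (1 - P) * \<phi>"
  assumes "0 \<le> p" "0 \<le> q" "p + q = 1" "0 \<le> P" "P < 1" "0 \<le> \<phi>" "0 \<le> \<gamma>" and pos: "0 < a + b"
  shows "ennreal (a / (a + b)) / ennreal (b / (a + b)) =
    (ennreal p / ennreal q + ennreal P) * (ennreal \<gamma> / ennreal \<phi> / ennreal (1 - P))"
proof -
  have ab: "0 \<le> a" "0 \<le> b" using assms by (auto simp: a_def b_def)
  show ?thesis
  proof (cases "b = 0")
    case True
    then have a: "0 < a" using pos by simp
    then have \<gamma>: "0 < \<gamma>" and pq: "0 < p + q * P"
      using assms unfolding a_def by (auto simp: zero_less_mult_iff)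
    have lhs: "ennreal (a / (a + b)) / ennreal (b / (a + b)) = \<top>"
      using True a by simp
    \<comment> \<open>As \<open>P < 1\<close>, \<open>b = 0\<close> leaves \<open>q = 0\<close> or
      \<open>\<phi> = 0\<close>. If \<open>q = 0\<close>, then \<open>p = 1\<close> and the prior
      odds are infinite; otherwise the likelihood ratio is infinite. In each case
      \<open>0 < a\<close> keeps the other factor from vanishing.\<close>
    show ?thesis
    proof (cases "q = 0")
      case True
      have "0 < ennreal \<gamma> / ennreal \<phi> / ennreal (1 - P)"
        using \<gamma> assms by (simp add: ennreal_zero_less_divide)
      then show ?thesis using True assms lhs by (simp add: ennreal_top_mult)
    next
      case False
      then have "\<phi> = 0" using \<open>b = 0\<close> assms by (auto simp: b_def)
      then have "ennreal \<gamma> / ennreal \<phi> / ennreal (1 - P) = \<top>"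
        using \<gamma> assms by (simp add: ennreal_top_divide)
      moreover have "ennreal p / ennreal q + ennreal P \<noteq> 0"
      proof
        assume "ennreal p / ennreal q + ennreal P = 0"
        then have "p = 0" "P = 0" using assms False by auto
        with pq show False by simp
      qed
      ultimately show ?thesis using lhs by (simp add: ennreal_mult_top)
    qed
  next
    case False
    then have b: "0 < b" using ab by simp
    then have q: "0 < q" and \<phi>: "0 < \<phi>"
      using assms unfolding b_def by (auto simp: zero_less_mult_iff)
    have "ennreal (a / (a + b)) / ennreal (b / (a + b)) = ennreal (a / b)"
      using ab b pos by (simp add: divide_ennreal)
    also have "a / b = (p / q + P) * (\<gamma> / \<phi> / (1 - P))"
      using q \<phi> assms unfolding a_def b_def by (simp add: field_simps)
    also have "ennreal \<dots> = ennreal (p / q + P) * ennreal (\<gamma> / \<phi> / (1 - P))"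
      using q \<phi> assms by (intro ennreal_mult) auto
    also have "ennreal (p / q + P) = ennreal p / ennreal q + ennreal P"
      using q assms by (simp add: divide_ennreal)
    also have "ennreal (\<gamma> / \<phi> / (1 - P)) = ennreal \<gamma> / ennreal \<phi> / ennreal (1 - P)"
      using \<phi> assms by (simp add: divide_ennreal)
    finally show ?thesis .
  qed
qed

section \<open>The observation filtration and predictability\<close>

context change_point_model
begin

text \<open>The generating events are preimages for \<open>count_space UNIV\<close>, while the model
  types \<open>X s\<close> with \<open>count_space {1..K}\<close>; the larger codomain matches the
  generators.\<close>

lemma X_measurable: "1 \<le> s \<Longrightarrow> X s \<in> measurable M (count_space UNIV)"
  using measurable_compose[OF X_rv, of s "\<lambda>x. x" "count_space UNIV"] by simp

lemma X_range: "1 \<le> s \<Longrightarrow> \<omega> \<in> space M \<Longrightarrow> X s \<omega> \<in> {1..K}"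
  using measurable_space[OF X_rv, of s \<omega>] by simp

lemma L_measurable: "L s \<in> measurable M (count_space UNIV)"
  using measurable_compose[OF L_rv, of "\<lambda>x. x" "count_space UNIV" s] by simp

lemma L_sets [measurable]: "{\<omega> \<in> space M. L s \<omega> = i} \<in> sets M"
  using measurable_sets[OF L_measurable[of s], of "{i}"] by (simp add: vimage_def Int_def conj_commute)

lemma L_compl: "{\<omega> \<in> space M. L s \<omega> = 0} = space M - {\<omega> \<in> space M. L s \<omega> = 1}"
  using L_eq[of _ s] by (auto split: if_splits)

lemma obs_events_sets: "obs_events M X Y s \<subseteq> sets M"
  unfolding obs_events_def
  by (intro UN_least Un_least rv_events_subset X_measurable Y_rv) auto

lemma obs_alg_subalgebra: "subalgebra M (obs_alg M X Y s)"
  unfolding obs_alg_def by (intro subalgebra_sigma obs_events_sets)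

lemma change_gen_sets:
  "1 \<le> s \<Longrightarrow> obs_events M X Y (s - 1) \<union> rv_events M (count_space UNIV) (X s)
      \<union> rv_events M (count_space UNIV) (L (s - 1)) \<subseteq> sets M"
  by (intro Un_least rv_events_subset X_measurable L_measurable obs_events_sets)

lemma response_gen_sets:
  "1 \<le> s \<Longrightarrow> obs_events M X Y (s - 1) \<union> rv_events M (count_space UNIV) (X s)
      \<union> (\<Union>r\<in>{0..s}. rv_events M (count_space UNIV) (L r)) \<subseteq> sets M"
  by (intro UN_least Un_least rv_events_subset X_measurable L_measurable obs_events_sets)

lemma space_algs [simp]:
  "space (obs_alg M X Y s) = space M"
  "space (change_alg M X Y L s) = space M"
  "space (response_alg M X Y L s) = space M"
  by (simp_all add: obs_alg_def change_alg_def response_alg_def space_measure_of_conv)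

lemma sets_obs_alg: "sets (obs_alg M X Y s) = sigma_sets (space M) (obs_events M X Y s)"
  unfolding obs_alg_def
  by (intro sets_measure_of subset_trans[OF obs_events_sets sets.space_closed])

lemma sets_change_alg:
  "1 \<le> s \<Longrightarrow> sets (change_alg M X Y L s) = sigma_sets (space M) (obs_events M X Y (s - 1) \<union>
      rv_events M (count_space UNIV) (X s) \<union> rv_events M (count_space UNIV) (L (s - 1)))"
  unfolding change_alg_def
  by (intro sets_measure_of subset_trans[OF change_gen_sets sets.space_closed])

lemma sets_response_alg:
  "1 \<le> s \<Longrightarrow> sets (response_alg M X Y L s) = sigma_sets (space M) (obs_events M X Y (s - 1) \<union>
      rv_events M (count_space UNIV) (X s) \<union> (\<Union>r\<in>{0..s}. rv_events M (count_space UNIV) (L r)))"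
  unfolding response_alg_def
  by (intro sets_measure_of subset_trans[OF response_gen_sets sets.space_closed])

lemma change_alg_subalgebra: "1 \<le> s \<Longrightarrow> subalgebra M (change_alg M X Y L s)"
  unfolding change_alg_def by (intro subalgebra_sigma change_gen_sets)

lemma response_alg_subalgebra: "1 \<le> s \<Longrightarrow> subalgebra M (response_alg M X Y L s)"
  unfolding response_alg_def by (intro subalgebra_sigma response_gen_sets)

lemma obs_alg_le_change_alg: "1 \<le> s \<Longrightarrow> sets (obs_alg M X Y (s - 1)) \<subseteq> sets (change_alg M X Y L s)"
  unfolding sets_obs_alg sets_change_alg by (intro sigma_sets_mono') auto

lemma obs_alg_le_response_alg: "1 \<le> s \<Longrightarrow> sets (obs_alg M X Y (s - 1)) \<subseteq> sets (response_alg M X Y L s)"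
  unfolding sets_obs_alg sets_response_alg by (intro sigma_sets_mono') auto

lemma obs_alg_mono: "r \<le> s \<Longrightarrow> sets (obs_alg M X Y r) \<subseteq> sets (obs_alg M X Y s)"
  unfolding sets_obs_alg obs_events_def by (intro sigma_sets_mono' UN_mono) auto

lemma L_event: "{\<omega> \<in> space M. L r \<omega> = i} \<in> rv_events M (count_space UNIV) (L r)"
  unfolding rv_events_def by (intro CollectI exI[of _ "{i}"]) auto

lemma L_change_alg: "1 \<le> s \<Longrightarrow> {\<omega> \<in> space M. L (s - 1) \<omega> = i} \<in> sets (change_alg M X Y L s)"
  unfolding sets_change_alg by (intro sigma_sets.Basic UnI2 L_event)

lemma L_response_alg: "1 \<le> s \<Longrightarrow> {\<omega> \<in> space M. L s \<omega> = i} \<in> sets (response_alg M X Y L s)"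
  unfolding sets_response_alg by (intro sigma_sets.Basic UnI2 UN_I[of s] L_event) simp

lemma rv_events_obs_alg:
  assumes "1 \<le> r" "r \<le> s"
  shows "rv_events M (count_space UNIV) (X r) \<subseteq> sets (obs_alg M X Y s)"
    and "rv_events M borel (Y r) \<subseteq> sets (obs_alg M X Y s)"
proof -
  have "rv_events M (count_space UNIV) (X r) \<union> rv_events M borel (Y r) \<subseteq> obs_events M X Y s"
    unfolding obs_events_def using assms by (intro UN_upper) simp
  also have "\<dots> \<subseteq> sets (obs_alg M X Y s)"
    unfolding sets_obs_alg by (rule sigma_sets_superset_generator)
  finally show "rv_events M (count_space UNIV) (X r) \<subseteq> sets (obs_alg M X Y s)"
    and "rv_events M borel (Y r) \<subseteq> sets (obs_alg M X Y s)"
    by simp_all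
qed

lemma X_obs_measurable:
  assumes "1 \<le> r" "r \<le> s"
  shows "X r \<in> measurable (obs_alg M X Y s) (count_space {1..K})"
proof (rule measurable_count_space_extend)
  show "X r \<in> measurable (obs_alg M X Y s) (count_space UNIV)"
    by (rule rv_events_measurable[OF _ rv_events_obs_alg(1)[OF assms]]) simp_all
  show "X r \<in> space (obs_alg M X Y s) \<rightarrow> {1..K}"
    using X_range[OF assms(1)] by (intro Pi_I) simp
qed simp

lemma Y_obs_measurable:
  assumes "1 \<le> r" "r \<le> s"
  shows "Y r \<in> measurable (obs_alg M X Y s) borel"
  by (rule rv_events_measurable[OF _ rv_events_obs_alg(2)[OF assms]]) simp_all

text \<open>From time \<open>2\<close> on a treatment is a measurable function of the earlier
  observations; the first one is constant, hence measurable for the trivial algebra at time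
  \<open>0\<close>.\<close>

lemma X_predictable:
  assumes rule: "assignment_rule M K X Y" and "1 \<le> s"
  shows "X s \<in> measurable (obs_alg M X Y (s - 1)) (count_space {1..K})"
proof (cases "s = 1")
  case True
  from rule obtain x where x: "x \<in> {1..K}" and eq: "\<And>\<omega>. \<omega> \<in> space M \<Longrightarrow> X 1 \<omega> = x"
    unfolding assignment_rule_def by auto
  have "(\<lambda>_. x) \<in> measurable (obs_alg M X Y (s - 1)) (count_space {1..K})"
    using x by simp
  then show ?thesis
    using eq True by (subst measurable_cong[where g="\<lambda>_. x"]) auto
next
  case False
  let ?F = "obs_alg M X Y (s - 1)"
  have "2 \<le> s" using False \<open>1 \<le> s\<close> by simp
  from rule[unfolded assignment_rule_def, THEN conjunct2, rule_format, OF this] obtain \<phi> where \<phi>: "\<phi> \<in> measurable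
          (PiM {1..s-1} (\<lambda>_. count_space {1..K}) \<Otimes>\<^sub>M PiM {1..s-1} (\<lambda>_. borel)) (count_space {1..K})"
    and eq: "\<And>\<omega>. \<omega> \<in> space M \<Longrightarrow> X s \<omega> = \<phi> (\<lambda>r\<in>{1..s-1}. X r \<omega>, \<lambda>r\<in>{1..s-1}. Y r \<omega>)"
    by blast
  have "(\<lambda>\<omega>. (\<lambda>r\<in>{1..s-1}. X r \<omega>, \<lambda>r\<in>{1..s-1}. Y r \<omega>)) \<in> measurable ?F
      (PiM {1..s-1} (\<lambda>_. count_space {1..K}) \<Otimes>\<^sub>M PiM {1..s-1} (\<lambda>_. borel))"
    by (intro measurable_Pair measurable_restrict X_obs_measurable Y_obs_measurable) auto
  from measurable_compose[OF this \<phi>] show ?thesis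
    using eq by (subst measurable_cong) auto
qed

lemma change_prob_range:
  assumes "1 \<le> s" "\<omega> \<in> space M"
  shows "0 \<le> change_prob \<pi> X s \<omega>" "change_prob \<pi> X s \<omega> < 1"
proof -
  have "(\<lambda>r\<in>{1..s}. X r \<omega>) \<in> {1..s} \<rightarrow>\<^sub>E {1..K}"
    using X_range[OF _ assms(2)] by (intro restrict_PiE_iff[THEN iffD2] ballI) simp
  from pi_range[OF assms(1) this]
  show "0 \<le> change_prob \<pi> X s \<omega>" "change_prob \<pi> X s \<omega> < 1"
    by (simp_all add: change_prob_def)
qed

text \<open>\<open>\<pi> s\<close> is an arbitrary function of the treatment history; it is
  measurable because a finite product of finite discrete spaces is discrete.\<close>

lemma change_prob_predictable:
  assumes rule: "assignment_rule M K X Y" and s: "1 \<le> s"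
  shows "change_prob \<pi> X s \<in> borel_measurable (obs_alg M X Y (s - 1))"
proof -
  let ?F = "obs_alg M X Y (s - 1)"
  have "X r \<in> measurable ?F (count_space {1..K})" if "r \<in> {1..s}" for r
    using that X_predictable[OF rule s] X_obs_measurable[of r "s - 1"] by (cases "r = s") auto
  then have "(\<lambda>\<omega>. \<lambda>r\<in>{1..s}. X r \<omega>) \<in> measurable ?F (PiM {1..s} (\<lambda>_. count_space {1..K}))"
    by (intro measurable_restrict)
  also have "PiM {1..s} (\<lambda>_. count_space {1..K}) = count_space ({1..s} \<rightarrow>\<^sub>E {1..K})"
    by (intro count_space_PiM_finite) auto
  finally show ?thesis
    unfolding change_prob_def by (rule measurable_compose) simp
qed

text \<open>The new observation is \<open>X s\<close> and \<open>Y s\<close>, but \<open>X s\<close>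
  is already a function of the past, so only \<open>Y s\<close> adds information. The pullback along
  \<open>(\<omega>, Y s \<omega>)\<close> is the form that \<open>bayes_formula\<close> takes as
  input.\<close>

lemma sets_obs_alg_step:
  assumes rule: "assignment_rule M K X Y" and s: "1 \<le> s"
  shows "sets (obs_alg M X Y s) =
    sets (vimage_algebra (space M) (\<lambda>\<omega>. (\<omega>, Y s \<omega>)) (obs_alg M X Y (s - 1) \<Otimes>\<^sub>M \<mu>))" (is "_ = sets ?V")
proof
  let ?F = "obs_alg M X Y (s - 1)"
  have sp: "space \<mu> = UNIV" using sets_eq_imp_space_eq[OF sets_mu] by simp
  have YV: "(\<lambda>\<omega>. (\<omega>, Y s \<omega>)) \<in> measurable ?V (?F \<Otimes>\<^sub>M \<mu>)"
    by (rule measurable_vimage_algebra1) (auto simp: space_pair_measure sp)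
  \<comment> \<open>Composing with the two projections makes the past and \<open>Y s\<close>
    measurable for the pullback; \<open>X s\<close> then follows by predictability.\<close>
  have id: "(\<lambda>\<omega>. \<omega>) \<in> measurable ?V ?F"
    using measurable_compose[OF YV measurable_fst] by simp
  have FV: "sets ?F \<subseteq> sets ?V"
  proof
    fix S assume "S \<in> sets ?F"
    with measurable_sets[OF id this] sets.sets_into_space[OF this] show "S \<in> sets ?V"
      by (simp add: Int_absorb2)
  qed
  have Y': "Y s \<in> measurable ?V borel"
    using measurable_compose[OF YV measurable_snd] by (simp add: measurable_cong_sets[OF refl sets_mu])
  have X': "X s \<in> measurable ?V (count_space UNIV)"
    using measurable_compose[OF measurable_compose[OF id X_predictable[OF rule s]] measurable_count_space]
    by simp
  have "obs_events M X Y s \<subseteq> obs_events M X Y (s - 1) \<union> rv_events M (count_space UNIV) (X s) \<union> rv_events M borel (Y s)"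
  proof -
    have "{1..s} = insert s {1..s-1}" using s by auto
    then show ?thesis unfolding obs_events_def by auto
  qed
  also have "\<dots> \<subseteq> sets ?V"
    using FV measurable_sets[OF X'] measurable_sets[OF Y']
    by (auto simp: sets_obs_alg rv_events_def intro: sigma_sets.Basic)
  finally show "sets (obs_alg M X Y s) \<subseteq> sets ?V"
    unfolding sets_obs_alg using sets.sigma_sets_subset[of "obs_events M X Y s" ?V] by simp
  \<comment> \<open>The pullback is the smallest algebra that makes the pair measurable, so it
    suffices that the pair is measurable for \<open>obs_alg M X Y s\<close>.\<close>
  show "sets ?V \<subseteq> sets (obs_alg M X Y s)"
  proof (rule sets_image_in_sets)
    have "(\<lambda>\<omega>. \<omega>) \<in> measurable (obs_alg M X Y s) ?F"
      using obs_alg_mono[of "s - 1" s] by (auto simp: measurable_def Int_absorb2 dest: sets.sets_into_space)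
    then show "(\<lambda>\<omega>. (\<omega>, Y s \<omega>)) \<in> measurable (obs_alg M X Y s) (?F \<Otimes>\<^sub>M \<mu>)"
      using Y_obs_measurable[of s s] s
      by (intro measurable_Pair) (auto simp: measurable_cong_sets[OF refl sets_mu])
  qed simp
qed

section \<open>One-step prediction of the latent state and of the response\<close>

lemma L_mono:
  assumes "\<omega> \<in> space M" "L (s - 1) \<omega> = 1"
  shows "L s \<omega> = 1"
proof -
  have "\<not> enat (s - 1) < \<theta> \<omega>"
    using L_eq[OF assms(1), of "s - 1"] assms(2) by (metis zero_neq_one)
  moreover have "enat (s - 1) \<le> enat s" by simp
  ultimately have "\<not> enat s < \<theta> \<omega>"
    by (meson order.strict_trans1)
  then show ?thesis
    using L_eq[OF assms(1), of s] by presburger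
qed

lemma cond_pr_compl:
  assumes "subalgebra M F"
  shows "AE \<omega> in M. cond_pr M F (\<lambda>\<omega>. L s \<omega> = 0) \<omega> = 1 - cond_pr M F (\<lambda>\<omega>. L s \<omega> = 1) \<omega>"
  unfolding cond_pr_def L_compl by (rule real_cond_exp_indicator_compl[OF assms L_sets])

lemma cond_pr_nonneg:
  assumes "subalgebra M F"
  shows "AE \<omega> in M. 0 \<le> cond_pr M F (\<lambda>\<omega>. L s \<omega> = i) \<omega>"
  unfolding cond_pr_def by (rule real_cond_exp_indicator_nonneg[OF assms L_sets])

text \<open>State \<open>1\<close> is absorbing, so it is occupied at time \<open>s\<close> either
  because it was at \<open>s - 1\<close> or through a jump at time \<open>s\<close>. The jump has
  conditional probability \<open>change_prob \<pi> X s\<close> given \<open>change_alg\<close>; as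
  this is \<open>F\<close>-measurable, averaging back to \<open>F\<close> only replaces the event of
  being in \<open>0\<close> by its posterior probability.\<close>

lemma cond_pr_change:
  assumes rule: "assignment_rule M K X Y" and s: "1 \<le> s"
  defines "F \<equiv> obs_alg M X Y (s - 1)"
  shows "AE \<omega> in M. cond_pr M F (\<lambda>\<omega>. L s \<omega> = 1) \<omega> =
    cond_pr M F (\<lambda>\<omega>. L (s - 1) \<omega> = 1) \<omega> +
    cond_pr M F (\<lambda>\<omega>. L (s - 1) \<omega> = 0) \<omega> * change_prob \<pi> X s \<omega>"
proof -
  let ?P = "change_prob \<pi> X s" and ?H = "change_alg M X Y L s"
  define E where "E i = {\<omega> \<in> space M. L (s - 1) \<omega> = i}" for i
  define E' where "E' = {\<omega> \<in> space M. L s \<omega> = 1}"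
  let ?p = "real_cond_exp M F (indicator (E 1))" and ?q = "real_cond_exp M F (indicator (E 0))"
  have [measurable]: "E i \<in> sets M" "E' \<in> sets M" for i
    by (auto simp: E_def E'_def)
  have sub: "subalgebra M F" unfolding F_def by (rule obs_alg_subalgebra)
  have subH: "subalgebra M ?H" by (rule change_alg_subalgebra[OF s])
  have PF[measurable]: "?P \<in> borel_measurable F"
    unfolding F_def by (rule change_prob_predictable[OF rule s])
  have FM: "D \<in> sets M" if "D \<in> sets F" for D
    using that sub by (auto simp: subalgebra_def)
  have P: "0 \<le> ?P \<omega>" if "\<omega> \<in> space M" for \<omega>
    using change_prob_range[OF s that] by simp
  have pq: "AE \<omega> in M. 0 \<le> ?p \<omega>" "AE \<omega> in M. 0 \<le> ?q \<omega>"
    by (rule real_cond_exp_indicator_nonneg[OF sub]; simp)+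
  \<comment> \<open>Conditional probabilities are nonnegative only almost everywhere, whereas the
    characterization wants a candidate nonnegative everywhere; \<open>max 0\<close> repairs this
    without changing the value almost surely.\<close>
  have "AE \<omega> in M. real_cond_exp M F (indicator E') \<omega> = max 0 (?p \<omega> + ?q \<omega> * ?P \<omega>)"
  proof (rule real_cond_exp_indicator_charact[OF sub])
    fix D assume D[measurable]: "D \<in> sets F"
    then have [measurable]: "D \<in> sets M" by (rule FM)
    \<comment> \<open>\<open>change\<close> speaks only about outcomes with
      \<open>L (s - 1) \<omega> = 0\<close>. That event belongs to \<open>change_alg\<close>, so it
      can be intersected with \<open>D\<close> before conditioning.\<close>
    have DH[measurable]: "D \<inter> E 0 \<in> sets ?H"
      using D obs_alg_le_change_alg[OF s] L_change_alg[OF s] unfolding F_def E_def by (intro sets.Int) auto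
    have 1: "emeasure M (E 1 \<inter> D) = (\<integral>\<^sup>+\<omega>. indicator D \<omega> * ennreal (?p \<omega>) \<partial>M)"
    proof -
      have "emeasure M (E 1 \<inter> D) = (\<integral>\<^sup>+\<omega>. indicator (E 1 \<inter> D) \<omega> \<partial>M)"
        by simp
      also have "\<dots> = (\<integral>\<^sup>+\<omega>. indicator D \<omega> * indicator (E 1) \<omega> \<partial>M)"
        by (intro nn_integral_cong) (auto simp: indicator_def)
      also have "\<dots> = (\<integral>\<^sup>+\<omega>. indicator D \<omega> * ennreal (?p \<omega>) \<partial>M)"
        by (rule nn_integral_real_cond_exp_indicator[OF sub]) simp_all
      finally show ?thesis .
    qed
    have 0: "emeasure M (E' \<inter> E 0 \<inter> D) = (\<integral>\<^sup>+\<omega>. (indicator D \<omega> * ennreal (?P \<omega>)) * ennreal (?q \<omega>) \<partial>M)"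
    proof -
      have "emeasure M (E' \<inter> E 0 \<inter> D) = (\<integral>\<^sup>+\<omega>. indicator (E' \<inter> E 0 \<inter> D) \<omega> \<partial>M)"
        by simp
      also have "\<dots> = (\<integral>\<^sup>+\<omega>. indicator (D \<inter> E 0) \<omega> * indicator E' \<omega> \<partial>M)"
        by (intro nn_integral_cong) (auto simp: indicator_def)
      also have "\<dots> = (\<integral>\<^sup>+\<omega>. indicator (D \<inter> E 0) \<omega> * ennreal (real_cond_exp M ?H (indicator E') \<omega>) \<partial>M)"
        by (rule nn_integral_real_cond_exp_indicator[OF subH]) simp_all
      also have "\<dots> = (\<integral>\<^sup>+\<omega>. (indicator D \<omega> * ennreal (?P \<omega>)) * indicator (E 0) \<omega> \<partial>M)"
        using change[OF s]
        by (intro nn_integral_cong_AE) (auto simp: cond_pr_def E_def E'_def indicator_def elim!: AE_mp)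
      \<comment> \<open>Second conditioning, now on \<open>F\<close>: the product of
        \<open>indicator D\<close> and \<open>?P\<close> is \<open>F\<close>-measurable and serves
        as the weight.\<close>
      also have "\<dots> = (\<integral>\<^sup>+\<omega>. (indicator D \<omega> * ennreal (?P \<omega>)) * ennreal (?q \<omega>) \<partial>M)"
        by (rule nn_integral_real_cond_exp_indicator[OF sub]) simp_all
      finally show ?thesis .
    qed
    have [measurable]: "?P \<in> borel_measurable M" by (rule measurable_from_subalg[OF sub PF])
    have "E' \<inter> D = (E 1 \<inter> D) \<union> (E' \<inter> E 0 \<inter> D)"
      using L_mono[of _ s] L_eq[of _ "s - 1"] unfolding E_def E'_def by (auto split: if_splits)
    then have "emeasure M (E' \<inter> D) = emeasure M (E 1 \<inter> D) + emeasure M (E' \<inter> E 0 \<inter> D)"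
      by (simp only:) (intro plus_emeasure[symmetric]; auto simp: E_def)
    also have "\<dots> = (\<integral>\<^sup>+\<omega>. indicator D \<omega> * ennreal (?p \<omega>) +
        (indicator D \<omega> * ennreal (?P \<omega>)) * ennreal (?q \<omega>) \<partial>M)"
      unfolding 0 1 by (rule nn_integral_add[symmetric]) measurable
    also have "\<dots> = (\<integral>\<^sup>+\<omega>. ennreal (max 0 (?p \<omega> + ?q \<omega> * ?P \<omega>)) * indicator D \<omega> \<partial>M)"
    proof (rule nn_integral_cong_AE)
      show "AE \<omega> in M. indicator D \<omega> * ennreal (?p \<omega>) +
          (indicator D \<omega> * ennreal (?P \<omega>)) * ennreal (?q \<omega>) =
          ennreal (max 0 (?p \<omega> + ?q \<omega> * ?P \<omega>)) * indicator D \<omega>"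
        using pq AE_space
      proof eventually_elim
        case (elim \<omega>)
        with P[of \<omega>] show ?case
          by (simp add: ennreal_mult distrib_left ac_simps)
      qed
    qed
    finally show "emeasure M (E' \<inter> D) = \<dots>" .
  qed simp_all
  with pq AE_space show ?thesis
    unfolding cond_pr_def E_def[symmetric] E'_def[symmetric]
  proof eventually_elim
    case (elim \<omega>)
    with P[of \<omega>] show ?case by simp
  qed
qed

text \<open>Conditioning proceeds in two stages. \<open>response_alg\<close> contains both
  \<open>D\<close> and the state event, so on \<open>L s \<omega> = i\<close> the response falls in
  \<open>C\<close> with probability the integral of \<open>h (X s \<omega>)\<close> over
  \<open>C\<close>. This depends only on the predictable \<open>X s\<close>, so conditioning on the
  past turns the state event into the factor \<open>c\<close>. A single set \<open>C\<close> is
  involved, so an exceptional null set depending on \<open>C\<close> does no harm.\<close>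

lemma response_rectangle:
  fixes h :: "nat \<Rightarrow> 'y \<Rightarrow> real"
  assumes rule: "assignment_rule M K X Y" and s: "1 \<le> s"
    and D: "D \<in> sets (obs_alg M X Y (s - 1))" and C: "C \<in> sets \<mu>"
    and dens: "\<And>x. x \<in> {1..K} \<Longrightarrow> is_density \<mu> (h x)"
    and h: "h = (if i = 0 then f else g)"
    and c: "AE \<omega> in M. cond_pr M (obs_alg M X Y (s - 1)) (\<lambda>\<omega>. L s \<omega> = i) \<omega> = c \<omega>"
  shows "emeasure M ({\<omega> \<in> space M. L s \<omega> = i} \<inter> (D \<inter> Y s -` C)) =
    (\<integral>\<^sup>+\<omega>. (\<integral>\<^sup>+y. ennreal (c \<omega> * h (X s \<omega>) y) * indicator C y \<partial>\<mu>) * indicator D \<omega> \<partial>M)"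
proof -
  let ?F = "obs_alg M X Y (s - 1)" and ?R = "response_alg M X Y L s"
  define E where "E = {\<omega> \<in> space M. L s \<omega> = i}"
  define W where "W = {\<omega> \<in> space M. Y s \<omega> \<in> C}"
  define k where "k x = (\<integral>\<^sup>+y. ennreal (h x y) * indicator C y \<partial>\<mu>)" for x
  have C': "C \<in> sets borel" using C sets_mu by simp
  have sub: "subalgebra M ?F" by (rule obs_alg_subalgebra)
  have [measurable]: "E \<in> sets M" by (simp add: E_def)
  have [measurable]: "W \<in> sets M"
    using measurable_sets[OF Y_rv[OF s] C'] by (simp add: W_def vimage_def Int_def conj_commute)
  have DM[measurable]: "D \<in> sets M" using D sub by (auto simp: subalgebra_def)
  have ED: "D \<inter> E \<in> sets ?R"
    using D obs_alg_le_response_alg[OF s] L_response_alg[OF s] unfolding E_def by (intro sets.Int) auto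
  have kF: "(\<lambda>\<omega>. k (X s \<omega>)) \<in> borel_measurable ?F"
    by (rule measurable_compose[OF X_predictable[OF rule s]]) simp
  \<comment> \<open>\<open>response\<close> is phrased with a Lebesgue integral of reals; a density
    is integrable, so this agrees with the nonnegative integral \<open>k x\<close>.\<close>
  have k: "ennreal (LINT y:C|\<mu>. h x y) = k x" if "x \<in> {1..K}" for x
  proof -
    have [measurable]: "h x \<in> borel_measurable \<mu>" and nn: "\<And>y. 0 \<le> h x y"
      and int1: "(\<integral>\<^sup>+ y. ennreal (h x y) \<partial>\<mu>) = 1"
      using dens[OF that] by (auto simp: is_density_def)
    have "integrable \<mu> (h x)"
      using nn int1 by (intro integrableI_nonneg) auto
    then have int: "integrable \<mu> (\<lambda>y. indicator C y * h x y)"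
      using integrable_mult_indicator[OF C, of "h x"] by simp
    have "ennreal (LINT y:C|\<mu>. h x y) = (\<integral>\<^sup>+y. ennreal (indicator C y * h x y) \<partial>\<mu>)"
      unfolding set_lebesgue_integral_def using nn int
      by (subst nn_integral_eq_integral) auto
    also have "\<dots> = k x"
      unfolding k_def by (intro nn_integral_cong) (auto simp: indicator_def)
    finally show ?thesis .
  qed
  have "emeasure M (E \<inter> (D \<inter> Y s -` C)) = (\<integral>\<^sup>+\<omega>. indicator (D \<inter> E \<inter> W) \<omega> \<partial>M)"
    by (simp, rule arg_cong[where f="emeasure M"]) (auto simp: E_def W_def)
  also have "\<dots> = (\<integral>\<^sup>+\<omega>. indicator (D \<inter> E) \<omega> * indicator W \<omega> \<partial>M)"
    by (intro nn_integral_cong) (auto simp: indicator_def)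
  also have "\<dots> = (\<integral>\<^sup>+\<omega>. indicator (D \<inter> E) \<omega> * ennreal (real_cond_exp M ?R (indicator W) \<omega>) \<partial>M)"
    using ED by (intro nn_integral_real_cond_exp_indicator[OF response_alg_subalgebra[OF s]]) simp_all
  also have "\<dots> = (\<integral>\<^sup>+\<omega>. (indicator D \<omega> * k (X s \<omega>)) * indicator E \<omega> \<partial>M)"
  proof (rule nn_integral_cong_AE)
    show "AE \<omega> in M. indicator (D \<inter> E) \<omega> * ennreal (real_cond_exp M ?R (indicator W) \<omega>) =
      (indicator D \<omega> * k (X s \<omega>)) * indicator E \<omega>"
      using response[OF s C'] AE_space
    proof eventually_elim
      case (elim \<omega>)
      have "ennreal (real_cond_exp M ?R (indicator W) \<omega>) = k (X s \<omega>)" if "\<omega> \<in> E"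
        using elim that k[OF X_range[OF s elim(2)]]
        by (cases "i = 0") (simp_all add: cond_pr_def W_def E_def h)
      then show ?case by (simp add: indicator_def)
    qed
  qed
  also have "\<dots> = (\<integral>\<^sup>+\<omega>. (indicator D \<omega> * k (X s \<omega>)) * ennreal (real_cond_exp M ?F (indicator E) \<omega>) \<partial>M)"
    using D kF by (intro nn_integral_real_cond_exp_indicator[OF sub]) simp_all
  also have "\<dots> = (\<integral>\<^sup>+\<omega>. (\<integral>\<^sup>+y. ennreal (c \<omega> * h (X s \<omega>) y) * indicator C y \<partial>\<mu>) * indicator D \<omega> \<partial>M)"
  proof (rule nn_integral_cong_AE)
    show "AE \<omega> in M. (indicator D \<omega> * k (X s \<omega>)) * ennreal (real_cond_exp M ?F (indicator E) \<omega>) =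
      (\<integral>\<^sup>+y. ennreal (c \<omega> * h (X s \<omega>) y) * indicator C y \<partial>\<mu>) * indicator D \<omega>"
      using c cond_pr_nonneg[OF sub, of s i] AE_space
    proof eventually_elim
      case (elim \<omega>)
      \<comment> \<open>At this outcome \<open>c \<omega>\<close> equals a nonnegative conditional
        probability, so it factors out of the integral below.\<close>
      have [measurable]: "h (X s \<omega>) \<in> borel_measurable \<mu>" "C \<in> sets \<mu>" and "\<And>y. 0 \<le> h (X s \<omega>) y"
        using dens[OF X_range[OF s elim(3)]] C by (auto simp: is_density_def)
      then have "(\<integral>\<^sup>+y. ennreal (c \<omega> * h (X s \<omega>) y) * indicator C y \<partial>\<mu>) =
          (\<integral>\<^sup>+y. ennreal (c \<omega>) * (ennreal (h (X s \<omega>) y) * indicator C y) \<partial>\<mu>)"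
        using elim by (simp add: ennreal_mult mult.assoc)
      also have "\<dots> = ennreal (c \<omega>) * k (X s \<omega>)"
        unfolding k_def by (rule nn_integral_cmult) measurable
      finally show ?case
        using elim by (simp add: cond_pr_def E_def ac_simps)
    qed
  qed
  finally show ?thesis by (simp add: E_def)
qed

section \<open>The recursion for the posterior odds\<close>

lemma post_odds_recursion:
  assumes rule: "assignment_rule M K X Y" and t: "1 \<le> t"
  shows "AE \<omega> in M. post_odds M X Y L t \<omega> =
      (post_odds M X Y L (t - 1) \<omega> + ennreal (change_prob \<pi> X t \<omega>)) *
      (lik_ratio f g X Y t \<omega> / ennreal (1 - change_prob \<pi> X t \<omega>))"
proof -
  let ?F = "obs_alg M X Y (t - 1)" and ?H = "obs_alg M X Y t"
  let ?P = "change_prob \<pi> X t"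
  define p where "p = cond_pr M ?F (\<lambda>\<omega>. L (t - 1) \<omega> = 1)"
  define q where "q = cond_pr M ?F (\<lambda>\<omega>. L (t - 1) \<omega> = 0)"
  \<comment> \<open>Clipping at zero gives nonnegativity everywhere, as \<open>bayes_formula\<close>
    demands: \<open>p\<close> and \<open>q\<close> are nonnegative only almost surely, and the
    remaining factors are controlled only on the sample space.\<close>
  define A where "A z = max 0 ((p (fst z) + q (fst z) * ?P (fst z)) * g (X t (fst z)) (snd z))" for z
  define B where "B z = max 0 ((q (fst z) * (1 - ?P (fst z))) * f (X t (fst z)) (snd z))" for z
  let ?E = "{\<omega> \<in> space M. L t \<omega> = 1}"
  have sub: "subalgebra M ?F" "subalgebra M ?H" by (rule obs_alg_subalgebra)+
  have [measurable]: "p \<in> borel_measurable ?F" "q \<in> borel_measurable ?F"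
    by (simp_all add: p_def q_def cond_pr_def)
  have [measurable]: "?P \<in> borel_measurable ?F"
    by (rule change_prob_predictable[OF rule t])
  have X': "(\<lambda>z. X t (fst z)) \<in> measurable (?F \<Otimes>\<^sub>M \<mu>) (count_space {1..K})"
    by (rule measurable_compose[OF measurable_fst X_predictable[OF rule t]])
  \<comment> \<open>Joint measurability is glued together from the sections \<open>h x\<close>,
    since \<open>X t\<close> takes finitely many values.\<close>
  have dens_meas: "(\<lambda>z. h (X t (fst z)) (snd z)) \<in> borel_measurable (?F \<Otimes>\<^sub>M \<mu>)"
    if "\<And>x. x \<in> {1..K} \<Longrightarrow> is_density \<mu> (h x)" for h :: "nat \<Rightarrow> 'y \<Rightarrow> real"
  proof (rule measurable_compose_countable'[OF _ X'])
    fix x assume "x \<in> {1..K}"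
    then have [measurable]: "h x \<in> borel_measurable \<mu>" using that by (simp add: is_density_def)
    show "(\<lambda>z. h x (snd z)) \<in> borel_measurable (?F \<Otimes>\<^sub>M \<mu>)" by measurable
  qed simp
  note [measurable] = dens_meas[OF f_density] dens_meas[OF g_density]
  have c1: "AE \<omega> in M. cond_pr M ?F (\<lambda>\<omega>. L t \<omega> = 1) \<omega> = p \<omega> + q \<omega> * ?P \<omega>"
    unfolding p_def q_def by (rule cond_pr_change[OF rule t])
  have pq: "AE \<omega> in M. q \<omega> = 1 - p \<omega>"
    unfolding p_def q_def by (rule cond_pr_compl[OF sub(1)])
  \<comment> \<open>With \<open>q = 1 - p\<close> the complement \<open>1 - (p + q * P)\<close>
    factors as \<open>q * (1 - P)\<close>.\<close>
  have c0: "AE \<omega> in M. cond_pr M ?F (\<lambda>\<omega>. L t \<omega> = 0) \<omega> = q \<omega> * (1 - ?P \<omega>)"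
    using cond_pr_compl[OF sub(1), of t] c1 pq
  proof eventually_elim
    case (elim \<omega>)
    show ?case unfolding elim by (simp add: algebra_simps)
  qed
  \<comment> \<open>Here \<open>G\<close> is the past algebra, \<open>H\<close> the present one and
    \<open>E\<close> the event \<open>L t \<omega> = 1\<close>; the rectangle hypotheses come from
    \<open>response_rectangle\<close> with the predictions \<open>c1\<close> and
    \<open>c0\<close>.\<close>
  have bayes: "AE \<omega> in M. 0 < A (\<omega>, Y t \<omega>) + B (\<omega>, Y t \<omega>) \<and>
    real_cond_exp M ?H (indicator ?E) \<omega> = A (\<omega>, Y t \<omega>) / (A (\<omega>, Y t \<omega>) + B (\<omega>, Y t \<omega>))"
  proof (rule bayes_formula[OF sub mu_sigma_finite _ _ sets_obs_alg_step[OF rule t]])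
    show "Y t \<in> measurable M \<mu>"
      using Y_rv[OF t] by (simp add: measurable_cong_sets[OF refl sets_mu])
    show "A \<in> borel_measurable (?F \<Otimes>\<^sub>M \<mu>)" "B \<in> borel_measurable (?F \<Otimes>\<^sub>M \<mu>)"
      unfolding A_def B_def by measurable
    show "0 \<le> A z" "0 \<le> B z" for z by (simp_all add: A_def B_def)
    fix D C assume DC: "D \<in> sets ?F" "C \<in> sets \<mu>"
    \<comment> \<open>Inside \<open>ennreal\<close> the clipping is invisible, because negative
      reals are sent to \<open>0\<close>.\<close>
    show "emeasure M (?E \<inter> (D \<inter> Y t -` C)) =
        (\<integral>\<^sup>+\<omega>. (\<integral>\<^sup>+y. ennreal (A (\<omega>, y)) * indicator C y \<partial>\<mu>) * indicator D \<omega> \<partial>M)"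
      using response_rectangle[OF rule t DC g_density _ c1] by (simp add: A_def)
    show "emeasure M ((space M - ?E) \<inter> (D \<inter> Y t -` C)) =
        (\<integral>\<^sup>+\<omega>. (\<integral>\<^sup>+y. ennreal (B (\<omega>, y)) * indicator C y \<partial>\<mu>) * indicator D \<omega> \<partial>M)"
      unfolding L_compl[symmetric] using response_rectangle[OF rule t DC f_density _ c0] by (simp add: B_def)
  qed simp
  have "AE \<omega> in M. 0 \<le> p \<omega>" "AE \<omega> in M. 0 \<le> q \<omega>"
    unfolding p_def q_def by (rule cond_pr_nonneg[OF sub(1)])+
  with pq bayes cond_pr_compl[OF sub(2), of t] AE_space show ?thesis
  proof eventually_elim
    case (elim \<omega>)
    let ?x = "X t \<omega>" and ?y = "Y t \<omega>"
    define a where "a = (p \<omega> + q \<omega> * ?P \<omega>) * g ?x ?y"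
    define b where "b = q \<omega> * (1 - ?P \<omega>) * f ?x ?y"
    note P = change_prob_range[OF t elim(4)]
    have fg: "0 \<le> f ?x ?y" "0 \<le> g ?x ?y"
      using f_density g_density X_range[OF t elim(4)] by (auto simp: is_density_def)
    \<comment> \<open>At a generic outcome all factors are nonnegative, so the clipping has no
      effect.\<close>
    have A: "A (\<omega>, ?y) = a" and B: "B (\<omega>, ?y) = b"
      unfolding A_def B_def a_def b_def using P fg elim by (auto intro!: max_absorb2)
    have pos: "0 < a + b" using elim A B by simp
    have 1: "cond_pr M ?H (\<lambda>\<omega>. L t \<omega> = 1) \<omega> = a / (a + b)"
      using elim A B by (simp add: cond_pr_def)
    \<comment> \<open>By the complement rule this is \<open>1 - a / (a + b)\<close>, and
      \<open>pos\<close> makes the division legitimate.\<close>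
    moreover have "cond_pr M ?H (\<lambda>\<omega>. L t \<omega> = 0) \<omega> = b / (a + b)"
      using elim(3) pos unfolding 1 by (simp add: field_simps)
    ultimately show ?case
      unfolding post_odds_def lik_ratio_def p_def[symmetric] q_def[symmetric]
      using posterior_odds_update[of "p \<omega>" "q \<omega>" "?P \<omega>" "f ?x ?y" "g ?x ?y"] elim P fg pos
      by (simp add: a_def b_def)
  qed
qed

end

theorem lemma2p1:
  fixes M :: "'a measure"
    and K :: nat
    and X :: "nat \<Rightarrow> 'a \<Rightarrow> nat"
    and Y :: "nat \<Rightarrow> 'a \<Rightarrow> 'y::polish_space"
    and L :: "nat \<Rightarrow> 'a \<Rightarrow> nat"
    and \<theta> :: "'a \<Rightarrow> enat"
    and \<mu> :: "'y measure"
    and f g :: "nat \<Rightarrow> 'y \<Rightarrow> real"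
    and \<pi>\<^sub>0 :: real
    and \<pi> :: "nat \<Rightarrow> (nat \<Rightarrow> nat) \<Rightarrow> real"
    and t :: nat
  assumes "change_point_model M K X Y L \<theta> \<mu> f g \<pi>\<^sub>0 \<pi>"
    and "assignment_rule M K X Y"
    and "1 \<le> t"
  shows "AE \<omega> in M.
    post_odds M X Y L t \<omega> =
      (post_odds M X Y L (t - 1) \<omega> + ennreal (change_prob \<pi> X t \<omega>)) *
      (lik_ratio f g X Y t \<omega> / ennreal (1 - change_prob \<pi> X t \<omega>))"
  using assms by (rule change_point_model.post_odds_recursion)

end
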